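(* Let $n$ be a positive integer with $n\equiv 1\pmod 2$. Then $$B_n^{(c)}(x_1,x_2,\dots,x_n)=\sum_{m_1+3m_3+\cdots+nm_n=n}\frac{n!}{m_1!\,m_3!\cdots m_n!}\Big(\frac{x_1}{1!}\Big)^{m_1}\Big(\frac{x_3}{3!\,2^2}\Big)^{m_3}\cdots\Big(\frac{x_n}{n!\,2^{n-1}}\Big)^{m_n},$$ where the sum is over all integers $m_1,m_3,\dots,m_n\ge 0$ (odd indices only) with $m_1+3m_3+\cdots+nm_n=n$.
   Context: The central complete Bell polynomials $B_n^{(c)}(x|x_1,x_2,\dots,x_n)$ are defined by the identity of formal power series in $t$ (with $x,x_1,x_2,\dots$ indeterminates or real numbers) $$\exp\Big(x\sum_{i=1}^\infty\Big(\frac12\Big)^i\big(x_i-(-1)^i x_i\big)\frac{t^i}{i!}\Big)=\sum_{n=0}^\infty B_n^{(c)}(x|x_1,x_2,\dots,x_n)\frac{t^n}{n!}.$$ One writes $B_n^{(c)}(x_1,\dots,x_n)=B_n^{(c)}(1|x_1,\dots,x_n)$, i.e. the value at $x=1$ (called the central complete Bell numbers). *)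

theory Defs
  imports "HOL-Computational_Algebra.Formal_Power_Series" "HOL-Library.FuncSet"
begin

text \<open>
  The variables \<open>x\<^sub>1, x\<^sub>2, \<dots>\<close> are given by a function \<open>xs :: nat \<Rightarrow> 'a\<close>; the value \<open>xs 0\<close> is
  never used. Working over an arbitrary field of characteristic 0 covers real values as well as
  indeterminates (elements of a field of rational functions).
\<close>

definition central_bell_exponent :: "'a::field_char_0 \<Rightarrow> (nat \<Rightarrow> 'a) \<Rightarrow> 'a fps" where
  "central_bell_exponent x xs =
     fps_const x *
     Abs_fps (\<lambda>i. if i = 0 then 0 else (1/2) ^ i * (xs i - (-1) ^ i * xs i) / fact i)"

definition central_bell_poly :: "nat \<Rightarrow> 'a::field_char_0 \<Rightarrow> (nat \<Rightarrow> 'a) \<Rightarrow> 'a" where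
  "central_bell_poly n x xs = fact n * fps_nth (fps_exp 1 oo central_bell_exponent x xs) n"

lemma central_bell_poly_gf:
  "fps_exp 1 oo central_bell_exponent x xs = Abs_fps (\<lambda>n. central_bell_poly n x xs / fact n)"
  by (simp add: fps_eq_iff central_bell_poly_def)

lemma central_bell_poly_cong:
  assumes "\<And>i. 1 \<le> i \<Longrightarrow> i \<le> n \<Longrightarrow> xs i = ys i"
  shows "central_bell_poly n x xs = central_bell_poly n x ys"
proof -
  let ?F = "central_bell_exponent x xs" and ?G = "central_bell_exponent x ys"
  have base: "fps_nth ?F i = fps_nth ?G i" if "i \<le> n" for i
    using that assms[of i] by (auto simp: central_bell_exponent_def)
  have pow: "fps_nth (?F ^ k) i = fps_nth (?G ^ k) i" if "i \<le> n" for k i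
    using that
  proof (induction k arbitrary: i)
    case (Suc k)
    then show ?case
      by (auto simp: fps_mult_nth base intro!: sum.cong)
  qed simp
  show ?thesis
    by (simp add: central_bell_poly_def fps_compose_nth pow)
qed

definition central_bell_number :: "nat \<Rightarrow> (nat \<Rightarrow> 'a::field_char_0) \<Rightarrow> 'a" where
  "central_bell_number n xs = central_bell_poly n 1 xs"

definition odd_indices :: "nat \<Rightarrow> nat set" where
  "odd_indices n = {i. 1 \<le> i \<and> i \<le> n \<and> odd i}"

text \<open>
  The families \<open>(m\<^sub>1, m\<^sub>3, \<dots>)\<close> of natural numbers, indexed by the odd numbers up to \<open>n\<close>, with
  \<open>m\<^sub>1 + 3 m\<^sub>3 + \<dots> = n\<close>. Extensionality makes each family a single function.
\<close>

definition odd_multiplicities :: "nat \<Rightarrow> (nat \<Rightarrow> nat) set" where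
  "odd_multiplicities n =
     {m \<in> odd_indices n \<rightarrow>\<^sub>E UNIV. (\<Sum>i\<in>odd_indices n. i * m i) = n}"

lemma finite_odd_indices [simp]: "finite (odd_indices n)"
  by (rule finite_subset[of _ "{..n}"]) (auto simp: odd_indices_def)

lemma finite_odd_multiplicities: "finite (odd_multiplicities n)"
proof (rule finite_subset)
  show "odd_multiplicities n \<subseteq> odd_indices n \<rightarrow>\<^sub>E {..n}"
  proof
    fix m assume m: "m \<in> odd_multiplicities n"
    have "m i \<le> n" if i: "i \<in> odd_indices n" for i
    proof -
      have "m i \<le> i * m i"
        using i by (simp add: odd_indices_def)
      also have "\<dots> \<le> (\<Sum>j\<in>odd_indices n. j * m j)"
        by (rule member_le_sum[where f = "\<lambda>j. j * m j"]) (use i in auto)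
      also have "\<dots> = n"
        using m by (simp add: odd_multiplicities_def)
      finally show ?thesis .
    qed
    with m show "m \<in> odd_indices n \<rightarrow>\<^sub>E {..n}"
      by (auto simp: odd_multiplicities_def PiE_iff)
  qed
qed (simp add: finite_PiE)

end

theory Submission
  imports Defs
begin

text \<open>
  Only the odd \<open>x\<^sub>i\<close> survive in the exponent, with coefficient \<open>x\<^sub>i / (i! 2\<^sup>i\<^sup>-\<^sup>1)\<close>, and terms beyond
  \<open>t\<^sup>n\<close> do not affect the coefficient of \<open>t\<^sup>n\<close>. So the exponent may be taken to be a finite sum of
  monomials; its exponential is the product of the exponentials of the monomials, whose coefficient
  at \<open>t\<^sup>n\<close> is read off by distributivity.
\<close>

lemma fps_exp_compose_deriv:
  fixes F :: "'a::field_char_0 fps"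
  assumes "fps_nth F 0 = 0"
  shows "fps_deriv (fps_exp 1 oo F) = (fps_exp 1 oo F) * fps_deriv F"
  by (simp add: fps_compose_deriv assms)

text \<open>A series with zero derivative and constant term 1 is 1. This applies to the product of
  the exponentials of \<open>F + G\<close>, \<open>- F\<close> and \<open>- G\<close>, where the
  logarithmic derivatives cancel, and to the exponentials of \<open>H\<close> and
  \<open>- H\<close>, which are therefore inverse to each other.\<close>

lemma fps_exp_compose_add:
  fixes F G :: "'a::field_char_0 fps"
  assumes F: "fps_nth F 0 = 0" and G: "fps_nth G 0 = 0"
  shows "fps_exp 1 oo (F + G) = (fps_exp 1 oo F) * (fps_exp 1 oo G)"
proof -
  let ?E = "\<lambda>H :: 'a fps. fps_exp 1 oo H"
  have const: "H = 1" if "fps_deriv H = 0" "fps_nth H 0 = 1" for H :: "'a fps"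
    using that by (simp add: fps_deriv_eq_0_iff)
  have inv: "?E H * ?E (- H) = 1" if "fps_nth H 0 = 0" for H
    by (rule const) (simp_all add: that fps_exp_compose_deriv algebra_simps)
  have one: "?E (F + G) * ?E (- F) * ?E (- G) = 1"
    by (rule const) (simp_all add: F G fps_exp_compose_deriv algebra_simps)
  have "?E (F + G) = ?E (F + G) * (?E F * ?E (- F)) * (?E G * ?E (- G))"
    by (simp add: inv F G)
  also have "\<dots> = (?E (F + G) * ?E (- F) * ?E (- G)) * (?E F * ?E G)"
    by (simp only: ac_simps)
  finally show ?thesis by (simp add: one)
qed

lemma fps_exp_compose_sum:
  fixes F :: "'b \<Rightarrow> 'a::field_char_0 fps"
  assumes "finite I" and "\<And>i. i \<in> I \<Longrightarrow> fps_nth (F i) 0 = 0"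
  shows "fps_exp 1 oo (\<Sum>i\<in>I. F i) = (\<Prod>i\<in>I. fps_exp 1 oo F i)"
  using assms
  by (induction I rule: finite_induct) (simp_all add: fps_exp_compose_add fps_sum_nth)

text \<open>For \<open>i > 0\<close> at most one summand is nonzero. Keeping the conditional sum
  avoids a case split on whether \<open>i\<close> divides \<open>k\<close>, and prepares the
  exchange of sums in the product formula.\<close>

lemma fps_exp_compose_monom_nth:
  fixes c :: "'a::field_char_0"
  shows "fps_nth (fps_exp 1 oo (fps_const c * fps_X ^ i)) k =
    (\<Sum>j\<le>k. if k = i * j then c ^ j / fact j else 0)"
  by (auto simp: fps_compose_nth power_mult_distrib fps_const_power power_mult [symmetric]
      fps_X_power_nth atLeast0AtMost intro!: sum.cong)

lemma fps_exp_compose_monom_mult_nth: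
  fixes c :: "'a::field_char_0"
  assumes "i > 0"
  shows "fps_nth ((fps_exp 1 oo (fps_const c * fps_X ^ i)) * P) n =
    (\<Sum>j | i * j \<le> n. c ^ j / fact j * fps_nth P (n - i * j))"
proof -
  have le: "j \<le> i * j" for j
    using assms by simp
  have "fps_nth ((fps_exp 1 oo (fps_const c * fps_X ^ i)) * P) n =
      (\<Sum>k\<le>n. \<Sum>j\<le>k. if k = i * j then c ^ j / fact j * fps_nth P (n - k) else 0)"
    by (auto simp: fps_mult_nth fps_exp_compose_monom_nth atLeast0AtMost sum_distrib_right
        intro!: sum.cong)
  \<comment> \<open>The range of \<open>j\<close> must not depend on \<open>k\<close> before the
    sums are swapped; the added terms vanish because \<open>k = i * j\<close> forces
    \<open>j \<le> k\<close>.\<close>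
  also have "\<dots> = (\<Sum>k\<le>n. \<Sum>j\<le>n. if k = i * j then c ^ j / fact j * fps_nth P (n - k) else 0)"
    by (intro sum.cong refl sum.mono_neutral_left) (use le in auto)
  also have "\<dots> = (\<Sum>j\<le>n. \<Sum>k\<le>n. if k = i * j then c ^ j / fact j * fps_nth P (n - k) else 0)"
    by (rule sum.swap)
  also have "\<dots> = (\<Sum>j\<le>n. if i * j \<le> n then c ^ j / fact j * fps_nth P (n - i * j) else 0)"
    by (simp add: sum.delta)
  also have "\<dots> = (\<Sum>j | i * j \<le> n. c ^ j / fact j * fps_nth P (n - i * j))"
    by (rule sum.mono_neutral_cong_right) (auto intro: order_trans [OF le])
  finally show ?thesis .
qed

lemma finite_weighted_multiplicities:
  fixes I :: "nat set"
  assumes "finite I" and "0 \<notin> I"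
  shows "finite {m \<in> I \<rightarrow>\<^sub>E UNIV. (\<Sum>i\<in>I. i * m i) = n}"
proof (rule finite_subset)
  show "{m \<in> I \<rightarrow>\<^sub>E UNIV. (\<Sum>i\<in>I. i * m i) = n} \<subseteq> I \<rightarrow>\<^sub>E {..n}"
  proof
    fix m assume m: "m \<in> {m \<in> I \<rightarrow>\<^sub>E UNIV. (\<Sum>i\<in>I. i * m i) = n}"
    have "m i \<le> n" if i: "i \<in> I" for i
    proof -
      have "m i \<le> i * m i"
        using i assms(2) by (cases i) auto
      also have "\<dots> \<le> (\<Sum>j\<in>I. j * m j)"
        by (rule member_le_sum[where f = "\<lambda>j. j * m j"]) (use i assms in auto)
      finally show ?thesis
        using m by simp
    qed
    with m show "m \<in> I \<rightarrow>\<^sub>E {..n}"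
      by (auto simp: PiE_iff)
  qed
qed (simp add: finite_PiE assms)

text \<open>Induction on \<open>I\<close>: the factor of a new index \<open>i\<close> contributes
  \<open>i * j\<close> to the degree, where \<open>j\<close> becomes \<open>m i\<close>, and the old
  factors supply the remaining \<open>n - i * j\<close>. This is why \<open>n\<close> is left
  arbitrary.\<close>

lemma fps_prod_exp_compose_monom_nth:
  fixes c :: "nat \<Rightarrow> 'a::field_char_0"
  assumes "finite I" and "0 \<notin> I"
  shows "fps_nth (\<Prod>i\<in>I. fps_exp 1 oo (fps_const (c i) * fps_X ^ i)) n =
    (\<Sum>m | m \<in> I \<rightarrow>\<^sub>E UNIV \<and> (\<Sum>i\<in>I. i * m i) = n. \<Prod>i\<in>I. c i ^ m i / fact (m i))"
  using assms
proof (induction I arbitrary: n rule: finite_induct)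
  case empty
  \<comment> \<open>The empty product is 1, matched by the single empty family, which has weight
    0.\<close>
  have "{m. m = (\<lambda>_. undefined) \<and> n = 0} = (if n = 0 then {\<lambda>_::nat. undefined::nat} else {})"
    by auto
  then show ?case
    by (cases "n = 0") (simp_all add: PiE_empty_domain)
next
  case (insert i I)
  let ?M = "\<lambda>n. {m. m \<in> I \<rightarrow>\<^sub>E (UNIV :: nat set) \<and> (\<Sum>i\<in>I. i * m i) = n}"
  let ?f = "\<lambda>j. c i ^ j / fact j" and ?g = "\<lambda>m. \<Prod>i\<in>I. c i ^ m i / fact (m i)"
  from insert.prems have i: "i > 0" and I: "0 \<notin> I" by auto
  have fin: "finite {j. i * j \<le> n}"
    by (rule finite_subset[of _ "{..n}"]) (use i in \<open>auto intro: order_trans[rotated]\<close>)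
  \<comment> \<open>As \<open>i \<notin> I\<close>, changing a family at \<open>i\<close> affects
    neither its weight nor its product over \<open>I\<close>.\<close>
  have upd: "(\<Sum>k\<in>I. k * (if k = i then j else m k)) = (\<Sum>k\<in>I. k * m k)"
    "(\<Prod>k\<in>I. c k ^ (if k = i then j else m k) / fact (if k = i then j else m k)) = ?g m" for m j
    using insert.hyps by (auto intro!: sum.cong prod.cong)
  have "fps_nth (\<Prod>i\<in>insert i I. fps_exp 1 oo (fps_const (c i) * fps_X ^ i)) n =
      (\<Sum>j | i * j \<le> n. \<Sum>m\<in>?M (n - i * j). ?f j * ?g m)"
    using insert.hyps
    by (simp add: fps_exp_compose_monom_mult_nth [OF i] insert.IH [OF I] sum_distrib_left)
  also have "\<dots> = (\<Sum>(j, m)\<in>(SIGMA j:{j. i * j \<le> n}. ?M (n - i * j)). ?f j * ?g m)"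
    using fin finite_weighted_multiplicities [OF insert.hyps(1) I]
    by (intro sum.Sigma) auto
  also have "\<dots> = (\<Sum>m | m \<in> insert i I \<rightarrow>\<^sub>E UNIV \<and> (\<Sum>i\<in>insert i I. i * m i) = n.
      \<Prod>i\<in>insert i I. c i ^ m i / fact (m i))"
    \<comment> \<open>A family on \<open>insert i I\<close> corresponds to its value at
      \<open>i\<close> and its restriction to \<open>I\<close>; resetting the value at
      \<open>i\<close> to \<open>undefined\<close> makes the restriction extensional.\<close>
    by (rule sum.reindex_bij_witness
        [where i = "\<lambda>m. (m i, m(i := undefined))" and j = "\<lambda>(j, m). m(i := j)"])
      (use insert.hyps in \<open>auto simp: upd PiE_iff extensional_def fun_upd_idem_iff\<close>)
  finally show ?case .
qed

text \<open>Even coefficients cancel; odd ones double, which turns \<open>(1/2) ^ i\<close> into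
  \<open>1 / 2 ^ (i - 1)\<close>. The vanishing hypothesis makes the series a finite sum.\<close>

lemma central_bell_exponent_eq_sum:
  fixes xs :: "nat \<Rightarrow> 'a::field_char_0"
  assumes "\<And>i. i > n \<Longrightarrow> xs i = 0"
  shows "central_bell_exponent 1 xs =
    (\<Sum>i\<in>odd_indices n. fps_const (xs i / (fact i * 2 ^ (i - 1))) * fps_X ^ i)"
proof (rule fps_ext)
  fix k
  have "fps_nth (central_bell_exponent 1 xs) k =
      (if k \<in> odd_indices n then xs k / (fact k * 2 ^ (k - 1)) else 0)"
    using assms [of k]
    by (cases k) (auto simp: central_bell_exponent_def odd_indices_def power_one_over not_le)
  also have "\<dots> = fps_nth (\<Sum>i\<in>odd_indices n.
      fps_const (xs i / (fact i * 2 ^ (i - 1))) * fps_X ^ i) k"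
    by (simp add: fps_sum_nth fps_X_power_nth sum.delta if_distrib cong: if_cong)
  finally show "fps_nth (central_bell_exponent 1 xs) k = \<dots>" .
qed

theorem theorem2p4:
  fixes xs :: "nat \<Rightarrow> 'a::field_char_0" and n :: nat
  assumes "n > 0" and "odd n"
  shows "central_bell_number n xs =
    (\<Sum>m\<in>odd_multiplicities n.
       fact n / (\<Prod>i\<in>odd_indices n. fact (m i)) *
       (\<Prod>i\<in>odd_indices n. (xs i / (fact i * 2 ^ (i - 1))) ^ m i))"
proof -
  \<comment> \<open>Cutting the variables off after \<open>n\<close> makes the exponent a polynomial
    without changing the Bell number of index \<open>n\<close>.\<close>
  define ys where "ys = (\<lambda>i. if i \<le> n then xs i else 0)"
  let ?c = "\<lambda>i. ys i / (fact i * 2 ^ (i - 1))"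
  have I: "0 \<notin> odd_indices n" and ys: "\<And>i. i \<in> odd_indices n \<Longrightarrow> ys i = xs i"
    by (auto simp: odd_indices_def ys_def)
  have "central_bell_number n xs = central_bell_poly n 1 ys"
    unfolding central_bell_number_def by (rule central_bell_poly_cong) (simp add: ys_def)
  also have "\<dots> = fact n * fps_nth
      (fps_exp 1 oo (\<Sum>i\<in>odd_indices n. fps_const (?c i) * fps_X ^ i)) n"
    unfolding central_bell_poly_def
    by (subst central_bell_exponent_eq_sum [of n]) (simp_all add: ys_def)
  also have "\<dots> = fact n * fps_nth
      (\<Prod>i\<in>odd_indices n. fps_exp 1 oo (fps_const (?c i) * fps_X ^ i)) n"
    by (subst fps_exp_compose_sum) (auto simp: odd_indices_def)
  also have "\<dots> = fact n * (\<Sum>m\<in>odd_multiplicities n. \<Prod>i\<in>odd_indices n. ?c i ^ m i / fact (m i))"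
    by (simp add: fps_prod_exp_compose_monom_nth [OF finite_odd_indices I] odd_multiplicities_def)
  also have "\<dots> = (\<Sum>m\<in>odd_multiplicities n.
       fact n / (\<Prod>i\<in>odd_indices n. fact (m i)) *
       (\<Prod>i\<in>odd_indices n. (xs i / (fact i * 2 ^ (i - 1))) ^ m i))"
    by (simp add: sum_distrib_left prod_dividef ys)
  finally show ?thesis .
qed

end
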